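(* Let $A\in\mathbb R^{n\times n}$ be symmetric with spectrum in $[-1,1]$, let $x_1,\dots,x_n$ be orthonormal eigenvectors of $A$ corresponding to the eigenvalues $\lambda_1,\dots,\lambda_n$ labeled in any desired order, let $V\in\mathbb R^{n\times\ell}$, and let $$S=(S_0,S_1,\dots,S_{M-1}),\qquad S_k=F_d(t^k)(A)V,$$ where $F_d$ is the Chebyshev--Jackson expansion operator defined in the context. Let $1\le i\le n-\ell+1$, let $N_i=\{1,2,\dots,n\}\setminus\{i,\dots,i+\ell-1\}$, and suppose that the $\ell\times\ell$ matrix $B=(x_i,\dots,x_{i+\ell-1})^TV$ is nonsingular. Then there exists a unique $v_i\in\mathcal R(V)$, namely $v_i=VB^{-1}e_1$ (with $e_1$ the first column of the $\ell\times\ell$ identity matrix), such that $$x_i^Tv_i=1\quad\text{and}\quad x_j^Tv_i=0,\ \ j=i+1,\dots,i+\ell-1,$$ and $$\tan\angle(\mathcal R(S),x_i)\le\min_{\substack{p\in\mathcal P_{M-1}\\ F_d(p)(\lambda_i)\ne0}}\ \max_{j\in N_i}\frac{|F_d(p)(\lambda_j)|}{|F_d(p)(\lambda_i)|}\cdot\tan\angle(v_i,x_i).$$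
   Context: $\mathcal R(X)$ denotes the column space of $X$, and $\mathcal P_{M-1}$ the real polynomials of degree at most $M-1$; $M,\ell,d\ge1$ are integers with $\ell\le n$. Let $[a,b]\subset[-1,1]$ with $a<b$. $T_j$ is the Chebyshev polynomial of the first kind of degree $j$. For a real polynomial $p$, the Chebyshev--Jackson expansion of degree $d$ (an approximation of $p\cdot h$, where $h$ is the indicator-type step function of $[a,b]$) is the polynomial $$F_d(p)(t)=\frac{c_0}{2}+\sum_{j=1}^d\rho_{j,d}\,c_j\,T_j(t),\qquad c_j=\frac2\pi\int_a^b\frac{p(t)T_j(t)}{\sqrt{1-t^2}}\,dt,$$ $$\rho_{j,d}=\frac{\sin((j+1)\alpha_d)}{(d+2)\sin(\alpha_d)}+\Bigl(1-\frac{j+1}{d+2}\Bigr)\cos(j\alpha_d),\qquad \alpha_d=\frac{\pi}{d+2}.$$ $F_d(t^k)(A)$ is the matrix polynomial obtained by evaluating the polynomial $F_d(t^k)$ at $A$. For nonzero vectors $u,x$, $\angle(u,x)\in[0,\pi/2]$ is the acute angle between the lines they span (tangent $+\infty$ when orthogonal), and $\tan\angle(\mathcal R(S),x)=\min_{0\ne u\in\mathcal R(S)}\tan\angle(u,x)$. The minimum over $p$ is understood as an infimum, with the bound being vacuous if no $p\in\mathcal P_{M-1}$ has $F_d(p)(\lambda_i)\ne0$. *)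

theory Defs
  imports "HOL-Analysis.Analysis" "Jordan_Normal_Form.Spectral_Radius"
begin

unbundle no vec_syntax

fun cheb_T :: "nat \<Rightarrow> real poly" where
  "cheb_T 0 = 1"
| "cheb_T (Suc 0) = [:0, 1:]"
| "cheb_T (Suc (Suc j)) = [:0, 2:] * cheb_T (Suc j) - cheb_T j"

lemma cheb_T_cos: "poly (cheb_T j) (cos t) = cos (real j * t)"
proof (induction j rule: cheb_T.induct)
  case (3 j)
  have *: "cos ((1 + real j) * t + t) + cos ((1 + real j) * t - t) = 2 * cos t * cos ((1 + real j) * t)"
    by (simp add: cos_add cos_diff)
  have "(1 + real j) * t + t = (2 + real j) * t" "(1 + real j) * t - t = real j * t"
    by (simp_all add: algebra_simps)
  then show ?case using 3 * by simp
qed simp_all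

definition jackson_alpha :: "nat \<Rightarrow> real" where
  "jackson_alpha d = pi / (real d + 2)"

definition jackson_rho :: "nat \<Rightarrow> nat \<Rightarrow> real" where
  "jackson_rho j d =
     sin ((real j + 1) * jackson_alpha d) / ((real d + 2) * sin (jackson_alpha d))
     + (1 - (real j + 1) / (real d + 2)) * cos (real j * jackson_alpha d)"

text \<open>
  If \<open>a = -1\<close> or \<open>b = 1\<close> the integrand has an (integrable) endpoint singularity;
  the value \<open>0\<close> it takes there by \<open>x / 0 = 0\<close> does not affect the integral.
\<close>

definition cheb_coeff :: "real \<Rightarrow> real \<Rightarrow> real poly \<Rightarrow> nat \<Rightarrow> real" where
  "cheb_coeff a b p j =
     2 / pi * integral {a..b} (\<lambda>t. poly p t * poly (cheb_T j) t / sqrt (1 - t\<^sup>2))"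

definition CJ_expansion :: "nat \<Rightarrow> real \<Rightarrow> real \<Rightarrow> real poly \<Rightarrow> real poly" where
  "CJ_expansion d a b p =
     [:cheb_coeff a b p 0 / 2:]
     + (\<Sum>j=1..d. Polynomial.smult (jackson_rho j d * cheb_coeff a b p j) (cheb_T j))"

definition mat_poly :: "'a::comm_ring_1 poly \<Rightarrow> 'a Matrix.mat \<Rightarrow> 'a Matrix.mat" where
  "mat_poly p A = Matrix.mat (dim_row A) (dim_col A)
     (\<lambda>(r, s). \<Sum>k\<le>degree p. Polynomial.coeff p k * (A ^\<^sub>m k) $$ (r, s))"

text \<open>The block matrix \<open>(X\<^sub>0, X\<^sub>1, \<dots>)\<close> of matrices with \<open>n\<close> rows each.\<close>

definition hcat :: "nat \<Rightarrow> 'a Matrix.mat list \<Rightarrow> 'a Matrix.mat" where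
  "hcat n Xs = mat_of_cols n (concat (map cols Xs))"

abbreviation column_space :: "real Matrix.mat \<Rightarrow> real Matrix.vec set" where
  "column_space X \<equiv> vec_space.col_space (dim_row X) X"

definition line_angle :: "real Matrix.vec \<Rightarrow> real Matrix.vec \<Rightarrow> real" where
  "line_angle u x = arccos (\<bar>u \<bullet> x\<bar> / (sqrt (u \<bullet> u) * sqrt (x \<bullet> x)))"

definition tan_angle :: "real Matrix.vec \<Rightarrow> real Matrix.vec \<Rightarrow> ennreal" where
  "tan_angle u x =
     (if line_angle u x = pi / 2 then \<infinity> else ennreal (tan (line_angle u x)))"

text \<open>
  This is the minimum over the nonzero vectors of \<open>W\<close>. It is attained for every nonzero subspace \<open>W\<close>;
  for the zero subspace the value is \<open>\<infinity>\<close>.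
\<close>

definition tan_angle_space :: "real Matrix.vec set \<Rightarrow> real Matrix.vec \<Rightarrow> ennreal" where
  "tan_angle_space W x = (INF u \<in> W - {0\<^sub>v (dim_vec x)}. tan_angle u x)"

end

theory Submission
  imports Defs
begin

text \<open>
  The expansion operator \<open>F = F\<^sub>d\<close> is linear, so \<open>w = F(p)(A) v\<close> is a combination of the vectors
  \<open>F(t\<^sup>k)(A) V c\<close> with \<open>v = V c\<close> and lies in the column space of \<open>S\<close>. As \<open>A\<close> is symmetric,
  the eigenvector coordinates of \<open>w\<close> are those of \<open>v\<close>, the \<open>j\<close>-th one multiplied by
  \<open>F(p)(\<lambda>\<^sub>j)\<close>. Only the coordinate \<open>i\<close> and those in \<open>N\<^sub>i\<close> survive, and by Parseval
  the tangent of the angle to \<open>x\<^sub>i\<close> is the norm of the part in \<open>N\<^sub>i\<close> over the \<open>i\<close>-th coordinate.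
\<close>

unbundle no inner_syntax

section \<open>Linearity of the Chebyshev--Jackson expansion\<close>

text \<open>The antiderivative \<open>arcsin\<close> is continuous up to -1 and 1 but has the
  required derivative only strictly between them, so the interior form of the fundamental theorem
  absorbs the endpoint singularities. Nonnegativity then upgrades integrability to absolute
  integrability.\<close>

lemma absolutely_integrable_chebyshev_weight:
  assumes "-1 \<le> a" "b \<le> 1"
  shows "(\<lambda>t. 1 / sqrt (1 - t\<^sup>2)) absolutely_integrable_on {a..b::real}"
proof (cases "a \<le> b")
  case True
  have "((\<lambda>t. 1 / sqrt (1 - t\<^sup>2)) has_integral (arcsin b - arcsin a)) {a..b}"
  proof (rule fundamental_theorem_of_calculus_interior[OF True])
    show "continuous_on {a..b} arcsin"
      by (rule continuous_on_subset[OF continuous_on_arcsin']) (use assms in auto)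
    fix t assume "t \<in> {a<..<b}"
    then show "(arcsin has_vector_derivative 1 / sqrt (1 - t\<^sup>2)) (at t)"
      using DERIV_arcsin[of t] assms
      by (simp add: has_real_derivative_iff_has_vector_derivative inverse_eq_divide)
  qed
  then have "(\<lambda>t. 1 / sqrt (1 - t\<^sup>2)) integrable_on {a..b}" by blast
  then show ?thesis
  proof (rule nonnegative_absolutely_integrable_1)
    fix t assume "t \<in> {a..b}"
    then have "\<bar>t\<bar> \<le> 1" using assms by auto
    then show "0 \<le> 1 / sqrt (1 - t\<^sup>2)" by (simp add: abs_square_le_1)
  qed
qed simp

text \<open>A bounded measurable factor preserves absolute integrability, and \<open>f\<close> is
  one by continuity on a compact interval.\<close>

lemma integrable_chebyshev_weight_mult:
  assumes "-1 \<le> a" "b \<le> 1" "continuous_on {a..b} f"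
  shows "(\<lambda>t. f t / sqrt (1 - t\<^sup>2)) integrable_on {a..b::real}"
proof -
  have "(\<lambda>t. f t * (1 / sqrt (1 - t\<^sup>2))) absolutely_integrable_on {a..b}"
  proof (rule absolutely_integrable_bounded_measurable_product_real)
    show "f \<in> borel_measurable (lebesgue_on {a..b})"
      using assms(3) by (rule continuous_imp_measurable_on_sets_lebesgue) simp
    show "bounded (f ` {a..b})"
      by (rule compact_imp_bounded[OF compact_continuous_image[OF assms(3)]]) simp
  qed (use absolutely_integrable_chebyshev_weight[OF assms(1,2)] in auto)
  then show ?thesis by (auto dest: set_lebesgue_integral_eq_integral(1))
qed

text \<open>Splitting the integral requires both integrands to be integrable; the bounds on
  \<open>a\<close> and \<open>b\<close> guarantee this.\<close>

lemma cheb_coeff_add: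
  assumes "-1 \<le> a" "b \<le> 1"
  shows "cheb_coeff a b (p + q) j = cheb_coeff a b p j + cheb_coeff a b q j"
proof -
  have int: "(\<lambda>t. poly r t * poly (cheb_T j) t / sqrt (1 - t\<^sup>2)) integrable_on {a..b}" for r
    by (intro integrable_chebyshev_weight_mult assms continuous_intros)
  show ?thesis
    unfolding cheb_coeff_def
    by (simp add: distrib_right add_divide_distrib integral_add[OF int int] distrib_left)
qed

text \<open>A constant factor leaves \<open>integral\<close> in every case: when integrability
  fails, both sides are 0 by the default value.\<close>

lemma cheb_coeff_smult:
  "cheb_coeff a b (Polynomial.smult c p) j = c * cheb_coeff a b p j"
  unfolding cheb_coeff_def
  by (simp add: mult.assoc times_divide_eq_right[symmetric] del: times_divide_eq_right)

lemma CJ_expansion_add: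
  assumes "-1 \<le> a" "b \<le> 1"
  shows "CJ_expansion d a b (p + q) = CJ_expansion d a b p + CJ_expansion d a b q"
  unfolding CJ_expansion_def cheb_coeff_add[OF assms]
  by (simp add: distrib_left smult_add_left sum.distrib add_divide_distrib)

lemma CJ_expansion_smult:
  "CJ_expansion d a b (Polynomial.smult c p) = Polynomial.smult c (CJ_expansion d a b p)"
  unfolding CJ_expansion_def cheb_coeff_smult
  by (simp add: smult_add_right smult_sum2 mult.left_commute)

lemma CJ_expansion_sum:
  assumes "-1 \<le> a" "b \<le> 1" "finite I"
  shows "CJ_expansion d a b (\<Sum>k\<in>I. f k) = (\<Sum>k\<in>I. CJ_expansion d a b (f k))"
  using assms(3)
proof induction
  case empty
  \<comment> \<open>The empty sum is 0 times the zero polynomial, so homogeneity gives the value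
    0.\<close>
  show ?case using CJ_expansion_smult[of d a b 0 0] by simp
qed (simp add: CJ_expansion_add[OF assms(1,2)])

text \<open>The images of the monomials are the polynomials behind the blocks of \<open>S\<close>. A
  bound \<open>m\<close> in place of \<open>degree p\<close> lets the index range be fixed in
  advance, later as \<open>{..M - 1}\<close>.\<close>

lemma CJ_expansion_as_sum:
  assumes "-1 \<le> a" "b \<le> 1" "degree p \<le> m"
  shows "CJ_expansion d a b p
    = (\<Sum>k\<le>m. Polynomial.smult (Polynomial.coeff p k) (CJ_expansion d a b (monom 1 k)))"
proof -
  have "p = (\<Sum>k\<le>m. Polynomial.smult (Polynomial.coeff p k) (monom 1 k))"
    using poly_as_sum_of_monoms'[OF assms(3)] by (simp add: smult_monom)
  \<comment> \<open>\<open>p\<close> recurs inside its own expansion, so the equation is lifted by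
    congruence instead of being used for rewriting.\<close>
  then have "CJ_expansion d a b p
      = CJ_expansion d a b (\<Sum>k\<le>m. Polynomial.smult (Polynomial.coeff p k) (monom 1 k))"
    by (rule arg_cong)
  then show ?thesis by (simp add: CJ_expansion_sum[OF assms(1,2)] CJ_expansion_smult)
qed

section \<open>Matrix polynomials\<close>

lemma mat_poly_carrier [simp]: "A \<in> carrier_mat n n \<Longrightarrow> mat_poly p A \<in> carrier_mat n n"
  by (rule carrier_matI) (auto simp: mat_poly_def)

text \<open>Coefficients above the degree vanish, so polynomials of different degrees can be summed
  over one common range.\<close>

lemma mat_poly_index:
  assumes "A \<in> carrier_mat n n" "degree p \<le> m" "r < n" "s < n"
  shows "mat_poly p A $$ (r, s) = (\<Sum>k\<le>m. Polynomial.coeff p k * (A ^\<^sub>m k) $$ (r, s))"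
proof -
  have "(\<Sum>k\<le>degree p. Polynomial.coeff p k * (A ^\<^sub>m k) $$ (r, s))
      = (\<Sum>k\<le>m. Polynomial.coeff p k * (A ^\<^sub>m k) $$ (r, s))"
    by (rule sum.mono_neutral_left) (use assms(2) in \<open>auto simp: coeff_eq_0\<close>)
  moreover have "dim_row A = n" "dim_col A = n" using assms(1) by auto
  ultimately show ?thesis using assms(3,4) by (simp add: mat_poly_def)
qed

lemma mat_poly_0: "A \<in> carrier_mat n n \<Longrightarrow> mat_poly 0 A = 0\<^sub>m n n"
  by (intro eq_matI) (auto simp: mat_poly_def)

lemma mat_poly_add:
  assumes A: "A \<in> carrier_mat n n"
  shows "mat_poly (p + q) A = mat_poly p A + mat_poly q A"
proof (rule eq_matI)
  fix r s assume "r < dim_row (mat_poly p A + mat_poly q A)" "s < dim_col (mat_poly p A + mat_poly q A)"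
  then have rs: "r < n" "s < n" using A by (auto simp: mat_poly_def)
  let ?m = "max (degree p) (degree q)"
  have "degree (p + q) \<le> ?m" by (rule degree_add_le_max)
  from mat_poly_index[OF A this rs] mat_poly_index[OF A _ rs, of p ?m] mat_poly_index[OF A _ rs, of q ?m]
  have "mat_poly (p + q) A $$ (r, s) = mat_poly p A $$ (r, s) + mat_poly q A $$ (r, s)"
    by (simp add: distrib_right sum.distrib)
  then show "mat_poly (p + q) A $$ (r, s) = (mat_poly p A + mat_poly q A) $$ (r, s)"
    using A rs by (simp add: mat_poly_def)
qed (use A in \<open>auto simp: mat_poly_def\<close>)

lemma mat_poly_smult:
  assumes A: "A \<in> carrier_mat n n"
  shows "mat_poly (Polynomial.smult c p) A = c \<cdot>\<^sub>m mat_poly p A"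
proof (rule eq_matI)
  fix r s assume "r < dim_row (c \<cdot>\<^sub>m mat_poly p A)" "s < dim_col (c \<cdot>\<^sub>m mat_poly p A)"
  then have rs: "r < n" "s < n" using A by (auto simp: mat_poly_def)
  from mat_poly_index[OF A degree_smult_le rs, of c p] mat_poly_index[OF A order_refl rs, of p]
  have "mat_poly (Polynomial.smult c p) A $$ (r, s) = c * mat_poly p A $$ (r, s)"
    by (simp add: sum_distrib_left mult.assoc)
  then show "mat_poly (Polynomial.smult c p) A $$ (r, s) = (c \<cdot>\<^sub>m mat_poly p A) $$ (r, s)"
    using A rs by (simp add: mat_poly_def)
qed (use A in \<open>auto simp: mat_poly_def\<close>)

text \<open>Each factor \<open>A\<close> crosses the scalar product as \<open>A\<^sup>T\<close> and
  yields a factor \<open>c\<close>. The vector \<open>u\<close> is generalised because the induction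
  peels off the rightmost factor and continues with \<open>A *\<^sub>v u\<close>.\<close>

lemma scalar_prod_pow_mat_left_eigenvector:
  fixes A :: "'a::comm_ring_1 Matrix.mat"
  assumes A: "A \<in> carrier_mat n n" and y: "y \<in> carrier_vec n" and u: "u \<in> carrier_vec n"
    and ev: "A\<^sup>T *\<^sub>v y = c \<cdot>\<^sub>v y"
  shows "y \<bullet> (A ^\<^sub>m k *\<^sub>v u) = c ^ k * (y \<bullet> u)"
  using u
proof (induction k arbitrary: u)
  case 0
  then show ?case using A by simp
next
  case (Suc k)
  have Au: "A *\<^sub>v u \<in> carrier_vec n" using A Suc.prems by simp
  have "A ^\<^sub>m Suc k *\<^sub>v u = A ^\<^sub>m k *\<^sub>v (A *\<^sub>v u)"
    using A Suc.prems by (simp add: assoc_mult_mat_vec[of _ n n _ n])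
  then have "y \<bullet> (A ^\<^sub>m Suc k *\<^sub>v u) = c ^ k * (y \<bullet> (A *\<^sub>v u))"
    using Suc.IH[OF Au] by simp
  also have "y \<bullet> (A *\<^sub>v u) = (c \<cdot>\<^sub>v y) \<bullet> u"
    using transpose_vec_mult_scalar[OF A Suc.prems y] ev by simp
  also have "\<dots> = c * (y \<bullet> u)" using y Suc.prems by simp
  finally show ?case by (simp add: mult_ac)
qed

text \<open>\<open>mat_poly\<close> is defined entrywise, so the product is expanded into
  coordinates, and two exchanges of sums reduce the claim to powers of \<open>A\<close>.\<close>

lemma scalar_prod_mat_poly_left_eigenvector:
  fixes A :: "'a::comm_ring_1 Matrix.mat"
  assumes A: "A \<in> carrier_mat n n" and y: "y \<in> carrier_vec n" and u: "u \<in> carrier_vec n"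
    and ev: "A\<^sup>T *\<^sub>v y = c \<cdot>\<^sub>v y"
  shows "y \<bullet> (mat_poly p A *\<^sub>v u) = poly p c * (y \<bullet> u)"
proof -
  have pow: "A ^\<^sub>m k \<in> carrier_mat n n" for k using A by simp
  have entry: "(mat_poly p A *\<^sub>v u) $ r
      = (\<Sum>k\<le>degree p. Polynomial.coeff p k * (A ^\<^sub>m k *\<^sub>v u) $ r)" if r: "r < n" for r
  proof -
    have "(mat_poly p A *\<^sub>v u) $ r = (\<Sum>s=0..<n. mat_poly p A $$ (r, s) * u $ s)"
      using r u A by (simp add: scalar_prod_def mat_poly_def)
    also have "\<dots> = (\<Sum>s=0..<n. \<Sum>k\<le>degree p. Polynomial.coeff p k * ((A ^\<^sub>m k) $$ (r, s) * u $ s))"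
      by (rule sum.cong) (simp_all add: mat_poly_index[OF A order_refl r] sum_distrib_right mult.assoc)
    also have "\<dots> = (\<Sum>k\<le>degree p. Polynomial.coeff p k * (\<Sum>s=0..<n. (A ^\<^sub>m k) $$ (r, s) * u $ s))"
      by (subst sum.swap) (simp add: sum_distrib_left)
    also have "\<dots> = (\<Sum>k\<le>degree p. Polynomial.coeff p k * (A ^\<^sub>m k *\<^sub>v u) $ r)"
    proof (rule sum.cong)
      fix k
      show "Polynomial.coeff p k * (\<Sum>s=0..<n. (A ^\<^sub>m k) $$ (r, s) * u $ s)
          = Polynomial.coeff p k * (A ^\<^sub>m k *\<^sub>v u) $ r"
        using r u pow[of k] carrier_matD[OF pow[of k]] by (simp add: scalar_prod_def)
    qed simp
    finally show ?thesis .
  qed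
  have "y \<bullet> (mat_poly p A *\<^sub>v u) = (\<Sum>r=0..<n. y $ r * (mat_poly p A *\<^sub>v u) $ r)"
    using A by (simp add: scalar_prod_def mat_poly_def)
  also have "\<dots> = (\<Sum>r=0..<n. \<Sum>k\<le>degree p. Polynomial.coeff p k * (y $ r * (A ^\<^sub>m k *\<^sub>v u) $ r))"
    by (rule sum.cong) (simp_all add: entry sum_distrib_left mult_ac)
  also have "\<dots> = (\<Sum>k\<le>degree p. Polynomial.coeff p k * (\<Sum>r=0..<n. y $ r * (A ^\<^sub>m k *\<^sub>v u) $ r))"
    by (subst sum.swap) (simp add: sum_distrib_left)
  also have "\<dots> = (\<Sum>k\<le>degree p. Polynomial.coeff p k * (y \<bullet> (A ^\<^sub>m k *\<^sub>v u)))"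
  proof (rule sum.cong)
    fix k
    show "Polynomial.coeff p k * (\<Sum>r=0..<n. y $ r * (A ^\<^sub>m k *\<^sub>v u) $ r)
        = Polynomial.coeff p k * (y \<bullet> (A ^\<^sub>m k *\<^sub>v u))"
      using carrier_matD[OF pow[of k]] by (simp add: scalar_prod_def)
  qed simp
  also have "\<dots> = poly p c * (y \<bullet> u)"
    by (simp add: scalar_prod_pow_mat_left_eigenvector[OF assms] poly_altdef sum_distrib_right mult.assoc)
  finally show ?thesis .
qed

section \<open>Column spaces\<close>

lemma mem_column_space_iff:
  assumes "X \<in> carrier_mat n m"
  shows "w \<in> column_space X \<longleftrightarrow> (\<exists>c\<in>carrier_vec m. w = X *\<^sub>v c)"
proof -
  have X: "X \<in> carrier_mat (dim_row X) m" and m: "dim_col X = m" using assms by auto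
  show ?thesis unfolding vec_space.col_space_eq[OF X] m by (auto intro: mult_mat_vec_carrier[OF X])
qed

lemma column_space_add:
  assumes "u \<in> column_space X" "w \<in> column_space X"
  shows "u + w \<in> column_space X"
proof -
  have X: "X \<in> carrier_mat (dim_row X) (dim_col X)" by simp
  from assms obtain c e where c: "c \<in> carrier_vec (dim_col X)" "u = X *\<^sub>v c"
    and e: "e \<in> carrier_vec (dim_col X)" "w = X *\<^sub>v e"
    unfolding mem_column_space_iff[OF X] by blast
  then have "u + w = X *\<^sub>v (c + e)" using mult_add_distrib_mat_vec[OF X, of c e] by simp
  then show ?thesis unfolding mem_column_space_iff[OF X] using c e add_carrier_vec by blast
qed

lemma column_space_smult:
  assumes "u \<in> column_space X"
  shows "r \<cdot>\<^sub>v u \<in> column_space X"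
proof -
  have X: "X \<in> carrier_mat (dim_row X) (dim_col X)" by simp
  from assms obtain c where c: "c \<in> carrier_vec (dim_col X)" "u = X *\<^sub>v c"
    unfolding mem_column_space_iff[OF X] by blast
  then have "r \<cdot>\<^sub>v u = X *\<^sub>v (r \<cdot>\<^sub>v c)" using mult_mat_vec[OF X, of c r] by simp
  then show ?thesis unfolding mem_column_space_iff[OF X] using c smult_carrier_vec by blast
qed

lemma zero_in_column_space: "0\<^sub>v (dim_row X) \<in> column_space X"
proof -
  have X: "X \<in> carrier_mat (dim_row X) (dim_col X)" by simp
  have "0\<^sub>v (dim_row X) = X *\<^sub>v 0\<^sub>v (dim_col X)" by auto
  then show ?thesis unfolding mem_column_space_iff[OF X] using zero_carrier_vec by blast
qed

text \<open>Every column of a block is a column of the whole matrix, and spans are monotone. Equal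
  row counts ensure that \<open>mat_of_cols\<close> keeps the columns intact and that both spans lie
  in the same ambient space.\<close>

lemma hcat_block_column_space:
  assumes "\<And>Y. Y \<in> set Xs \<Longrightarrow> dim_row Y = n" and "X \<in> set Xs"
  shows "column_space X \<subseteq> column_space (hcat n Xs)"
proof -
  have sub: "set (concat (map cols Xs)) \<subseteq> carrier_vec n"
  proof
    fix c assume "c \<in> set (concat (map cols Xs))"
    then obtain Y where "Y \<in> set Xs" "c \<in> set (cols Y)" by auto
    then show "c \<in> carrier_vec n" using assms(1)[of Y] cols_dim[of Y] by auto
  qed
  have cols: "cols (hcat n Xs) = concat (map cols Xs)"
    unfolding hcat_def by (rule cols_mat_of_cols[OF sub])
  have "set (cols X) \<subseteq> set (cols (hcat n Xs))" unfolding cols using assms(2) by auto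
  moreover have "dim_row (hcat n Xs) = n" "dim_row X = n" using assms by (auto simp: hcat_def)
  ultimately show ?thesis
    using module.span_is_monotone[OF vec_module]
    unfolding vec_space.col_space_def by simp
qed

text \<open>Evaluation at \<open>A\<close> is linear in the polynomial, and a column space is closed
  under linear combinations. With \<open>q k\<close> the image of the \<open>k\<close>-th monomial,
  this places \<open>F(p)(A) v\<close> in the column space of \<open>S\<close>.\<close>

lemma mat_poly_sum_in_column_space:
  assumes A: "A \<in> carrier_mat (dim_row X) (dim_row X)" and u: "u \<in> carrier_vec (dim_row X)"
    and "finite I" and "\<And>k. k \<in> I \<Longrightarrow> mat_poly (q k) A *\<^sub>v u \<in> column_space X"
  shows "mat_poly (\<Sum>k\<in>I. Polynomial.smult (c k) (q k)) A *\<^sub>v u \<in> column_space X"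
  using assms(3,4)
proof induction
  case empty
  have "mat_poly 0 A *\<^sub>v u = 0\<^sub>v (dim_row X)" using u by (intro eq_vecI) (simp_all add: mat_poly_0[OF A])
  then show ?case using zero_in_column_space by simp
next
  case (insert k I)
  have "mat_poly (Polynomial.smult (c k) (q k)) A *\<^sub>v u = c k \<cdot>\<^sub>v (mat_poly (q k) A *\<^sub>v u)"
    using u carrier_matD[OF mat_poly_carrier[OF A, of "q k"]]
    by (intro eq_vecI) (simp_all add: mat_poly_smult[OF A])
  then have "mat_poly (\<Sum>k\<in>insert k I. Polynomial.smult (c k) (q k)) A *\<^sub>v u
      = c k \<cdot>\<^sub>v (mat_poly (q k) A *\<^sub>v u) + mat_poly (\<Sum>k\<in>I. Polynomial.smult (c k) (q k)) A *\<^sub>v u"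
    using insert.hyps u A
    by (simp add: mat_poly_add[OF A] add_mult_distrib_mat_vec[of _ "dim_row X" "dim_row X"])
  then show ?case using insert by (simp add: column_space_add column_space_smult)
qed

section \<open>Angles between vectors\<close>

text \<open>By Pythagoras \<open>e\<close> is the squared length of the part of \<open>u\<close>
  orthogonal to \<open>x\<close>. Cosine and sine of the angle are
  \<open>\<bar>u \<bullet> x\<bar>\<close> and \<open>sqrt e\<close> divided by the length of
  \<open>u\<close>, which cancels in the tangent.\<close>

lemma tan_angle_unit:
  fixes x u :: "real Matrix.vec"
  assumes "x \<bullet> x = 1" "(u \<bullet> x)\<^sup>2 + e = u \<bullet> u" "0 \<le> e" "u \<bullet> x \<noteq> 0"
  shows "tan_angle u x = ennreal (sqrt e / \<bar>u \<bullet> x\<bar>)"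
proof -
  let ?c = "\<bar>u \<bullet> x\<bar> / sqrt (u \<bullet> u)"
  have pos: "0 < u \<bullet> u" using assms(2-4) by (smt (verit) zero_less_power2)
  have "\<bar>u \<bullet> x\<bar> \<le> sqrt (u \<bullet> u)" using assms(2,3) by (intro real_le_rsqrt) simp
  then have c: "0 < ?c" "?c \<le> 1" using assms(4) pos by auto
  have angle: "line_angle u x = arccos ?c" by (simp add: line_angle_def assms(1))
  have cos: "cos (arccos ?c) = ?c" using c by (intro cos_arccos) auto
  \<comment> \<open>The cosine is positive, so the angle is not a right angle and the infinite
    branch of \<open>tan_angle\<close> is excluded.\<close>
  have ne: "arccos ?c \<noteq> pi / 2" using cos c(1) cos_pi_half by (metis less_irrefl)
  have "1 - ?c\<^sup>2 = e / (u \<bullet> u)"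
    using pos assms(2) by (simp add: power_divide field_simps)
  then have "sin (arccos ?c) = sqrt e / sqrt (u \<bullet> u)"
    using sin_arccos_abs[of ?c] c by (simp add: real_sqrt_divide)
  then have "tan (arccos ?c) = sqrt e / \<bar>u \<bullet> x\<bar>"
    unfolding tan_def cos using pos by simp
  then show ?thesis using ne by (simp add: tan_angle_def angle)
qed

text \<open>The matrix \<open>Q\<close> with rows \<open>x j\<close> satisfies
  \<open>Q * Q\<^sup>T = 1\<close>. For square matrices a one-sided inverse is two-sided, so
  \<open>Q\<^sup>T * Q = 1\<close> and \<open>Q\<close> preserves lengths; this replaces an argument
  that the \<open>x j\<close> span the space.\<close>

lemma parseval_orthonormal:
  fixes x :: "nat \<Rightarrow> real Matrix.vec"
  assumes x: "\<And>j. j < n \<Longrightarrow> x j \<in> carrier_vec n"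
    and orth: "\<And>j k. j < n \<Longrightarrow> k < n \<Longrightarrow> x j \<bullet> x k = (if j = k then 1 else 0)"
    and u: "u \<in> carrier_vec n"
  shows "u \<bullet> u = (\<Sum>j<n. (x j \<bullet> u)\<^sup>2)"
proof -
  define Q where "Q = mat_of_rows n (map x [0..<n])"
  have Q: "Q \<in> carrier_mat n n" by (simp add: Q_def mat_of_rows_def)
  have row: "row Q j = x j" if "j < n" for j
    using that x by (simp add: Q_def)
  have "Q * Q\<^sup>T = 1\<^sub>m n"
    by (rule eq_matI) (use Q in \<open>auto simp: row orth\<close>)
  then have "Q\<^sup>T * Q = 1\<^sub>m n" using mat_mult_left_right_inverse[OF Q] Q by simp
  then have "u \<bullet> u = (Q\<^sup>T * Q *\<^sub>v u) \<bullet> u" using u by simp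
  also have "\<dots> = (Q\<^sup>T *\<^sub>v (Q *\<^sub>v u)) \<bullet> u"
    using Q u by (simp add: assoc_mult_mat_vec[of _ n n _ n])
  also have "\<dots> = (Q *\<^sub>v u) \<bullet> (Q *\<^sub>v u)" using Q u by (intro transpose_vec_mult_scalar) auto
  also have "\<dots> = (\<Sum>j<n. (x j \<bullet> u)\<^sup>2)"
    using Q by (auto simp: scalar_prod_def[of "Q *\<^sub>v u"] row power2_eq_square atLeast0LessThan intro!: sum.cong)
  finally show ?thesis .
qed

theorem theorem4p1:
  fixes A V S B :: "real Matrix.mat"
    and x :: "nat \<Rightarrow> real Matrix.vec"
    and v :: "real Matrix.vec"
    and lam :: "nat \<Rightarrow> real"
    and a b :: real
    and n l M d i :: nat
    and N :: "nat set"
  assumes "1 \<le> M" and "1 \<le> l" and "1 \<le> d" and "l \<le> n"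
    and "-1 \<le> a" and "a < b" and "b \<le> 1"
    and A: "A \<in> carrier_mat n n" and "A\<^sup>T = A" and "spectrum A \<subseteq> {-1..1}"
    and "\<forall>j\<in>{1..n}. eigenvector A (x j) (lam j)"
    and "\<forall>j\<in>{1..n}. \<forall>k\<in>{1..n}. x j \<bullet> x k = (if j = k then 1 else 0)"
    and V: "V \<in> carrier_mat n l"
    and S: "S = hcat n (map (\<lambda>k. mat_poly (CJ_expansion d a b (monom 1 k)) A * V) [0..<M])"
    and "1 \<le> i" and "i \<le> n - l + 1"
    and N: "N = {1..n} - {i..i + l - 1}"
    and B: "B = (mat_of_cols n (map x [i..<i + l]))\<^sup>T * V"
    and "invertible_mat B"
    and v: "v = V *\<^sub>v (the (mat_inverse B) *\<^sub>v unit_vec l 0)"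
  shows "(\<exists>!w. w \<in> column_space V \<and> x i \<bullet> w = 1 \<and> (\<forall>j\<in>{i + 1..i + l - 1}. x j \<bullet> w = 0))
    \<and> (v \<in> column_space V \<and> x i \<bullet> v = 1 \<and> (\<forall>j\<in>{i + 1..i + l - 1}. x j \<bullet> v = 0))
    \<and> tan_angle_space (column_space S) (x i)
        \<le> (INF p \<in> {p. degree p \<le> M - 1 \<and> poly (CJ_expansion d a b p) (lam i) \<noteq> 0}.
             (SUP j\<in>N. ennreal (\<bar>poly (CJ_expansion d a b p) (lam j)\<bar>
                               / \<bar>poly (CJ_expansion d a b p) (lam i)\<bar>))
             * tan_angle v (x i))"
proof -
  note M = assms(1) and l = assms(2) and ln = assms(4) and i = assms(15,16)
  have AT: "A\<^sup>T = A" by fact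
  have ab: "-1 \<le> a" "b \<le> 1" by fact+
  \<comment> \<open>Symmetry of \<open>A\<close> makes every eigenvector a left eigenvector as
    well.\<close>
  have ev: "x j \<in> carrier_vec n" "A\<^sup>T *\<^sub>v x j = lam j \<cdot>\<^sub>v x j" if "j \<in> {1..n}" for j
    using assms(11) that A AT by (auto simp: eigenvector_def)
  have orth: "x j \<bullet> x k = (if j = k then 1 else 0)" if "j \<in> {1..n}" "k \<in> {1..n}" for j k
    using assms(12) that by blast
  have window: "i + r \<in> {1..n}" if "r < l" for r using that i ln by auto
  have in1: "i \<in> {1..n}" using window[of 0] l by simp

  \<comment> \<open>The dual vector \<open>v\<close> and its uniqueness\<close>
  let ?X = "mat_of_cols n (map x [i..<i + l])"
  have X: "?X \<in> carrier_mat n l" by (rule carrier_matI) simp_all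
  have Bc: "B \<in> carrier_mat l l" unfolding B using X V by auto
  have B_index: "(B *\<^sub>v c) $ r = x (i + r) \<bullet> (V *\<^sub>v c)"
    if r: "r < l" and c: "c \<in> carrier_vec l" for r c
  proof -
    have "B *\<^sub>v c = ?X\<^sup>T *\<^sub>v (V *\<^sub>v c)"
      unfolding B using X V c by (intro assoc_mult_mat_vec[of _ l n _ l]) auto
    then show ?thesis using r ev(1)[OF window[OF r]] by simp
  qed
  \<comment> \<open>\<open>mat_inverse\<close> is option-valued. The result \<open>None\<close>
    would mean that \<open>B\<close> is not a unit of the matrix ring, against its
    invertibility.\<close>
  obtain C where C: "C \<in> carrier_mat l l" "mat_inverse B = Some C" "B * C = 1\<^sub>m l" "C * B = 1\<^sub>m l"
  proof (cases "mat_inverse B")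
    case None
    from \<open>invertible_mat B\<close> obtain D where D: "B * D = 1\<^sub>m l" "D * B = 1\<^sub>m (dim_row D)"
      using Bc unfolding invertible_mat_def inverts_mat_def by auto
    \<comment> \<open>The inverse \<open>D\<close> comes without dimensions; they are read off from
      the two product equations.\<close>
    have "dim_col D = l" using arg_cong[OF D(1), of dim_col] by simp
    moreover have "dim_row D = l" using arg_cong[OF D(2), of dim_col] Bc by simp
    ultimately have "D \<in> carrier_mat l l" by auto
    then have "B \<in> Units (ring_mat TYPE(real) l ())"
      using D Bc unfolding Units_def by (auto simp: ring_mat_simps)
    then show ?thesis using mat_inverse(1)[OF Bc None, where b = "()"] by blast
  qed (use mat_inverse(2)[OF Bc] in blast)
  let ?c = "C *\<^sub>v unit_vec l 0"
  have c: "?c \<in> carrier_vec l" using C(1) by simp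
  have vVc: "v = V *\<^sub>v ?c" unfolding v C(2) by simp
  have Bc_e1: "B *\<^sub>v ?c = unit_vec l 0"
    using assoc_mult_mat_vec[OF Bc C(1), of "unit_vec l 0"] C(3) by simp
  \<comment> \<open>For a vector \<open>V *\<^sub>v e\<close> the duality conditions are the linear
    system with matrix \<open>B\<close>. Rows count from 0, so row \<open>r\<close> belongs to
    \<open>x (i + r)\<close> and the right-hand side is \<open>unit_vec l 0\<close>.\<close>
  have dual: "x i \<bullet> (V *\<^sub>v e) = 1 \<and> (\<forall>j\<in>{i + 1..i + l - 1}. x j \<bullet> (V *\<^sub>v e) = 0)
      \<longleftrightarrow> B *\<^sub>v e = unit_vec l 0" (is "?dual \<longleftrightarrow> _") if e: "e \<in> carrier_vec l" for e
  proof
    assume d: ?dual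
    show "B *\<^sub>v e = unit_vec l 0"
    proof (rule eq_vecI)
      fix r assume "r < dim_vec (unit_vec l 0 :: real Matrix.vec)"
      then have r: "r < l" by simp
      then show "(B *\<^sub>v e) $ r = unit_vec l 0 $ r"
        using d B_index[OF r e] l by (cases "r = 0") auto
    qed (use Bc in simp)
  next
    assume d: "B *\<^sub>v e = unit_vec l 0"
    have "x (i + r) \<bullet> (V *\<^sub>v e) = (if r = 0 then 1 else 0)" if "r < l" for r
      using B_index[OF that e] d that l by simp
    note * = this
    show ?dual
    proof (intro conjI ballI)
      show "x i \<bullet> (V *\<^sub>v e) = 1" using *[of 0] l by simp
      fix j assume "j \<in> {i + 1..i + l - 1}"
      then show "x j \<bullet> (V *\<^sub>v e) = 0" using *[of "j - i"] l by auto
    qed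
  qed
  have vcol: "v \<in> column_space V" unfolding mem_column_space_iff[OF V] vVc using c by blast
  have vdual: "x i \<bullet> v = 1" "\<And>j. j \<in> {i + 1..i + l - 1} \<Longrightarrow> x j \<bullet> v = 0"
    using dual[OF c] Bc_e1 unfolding vVc by blast+
  have unique: "w = v"
    if "w \<in> column_space V" "x i \<bullet> w = 1" "\<forall>j\<in>{i + 1..i + l - 1}. x j \<bullet> w = 0" for w
  proof -
    from that(1) obtain e where e: "e \<in> carrier_vec l" "w = V *\<^sub>v e"
      unfolding mem_column_space_iff[OF V] by blast
    then have "B *\<^sub>v e = unit_vec l 0" using dual that by blast
    \<comment> \<open>Multiplying the system by the left inverse \<open>C\<close> determines the
      coefficient vector \<open>e\<close>, hence \<open>w\<close>.\<close>
    then have "C *\<^sub>v (B *\<^sub>v e) = ?c" by simp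
    then show ?thesis
      using e C(4) assoc_mult_mat_vec[OF C(1) Bc e(1)] by (simp add: vVc)
  qed
  have vn: "v \<in> carrier_vec n" unfolding vVc using V c by simp
  have finN: "finite N" unfolding N by simp

  \<comment> \<open>The tangent in eigenvector coordinates\<close>
  have tan: "tan_angle u (x i) = ennreal (sqrt (\<Sum>j\<in>N. (x j \<bullet> u)\<^sup>2) / \<bar>x i \<bullet> u\<bar>)"
    if u: "u \<in> carrier_vec n" "x i \<bullet> u \<noteq> 0" "\<And>j. j \<in> {i + 1..i + l - 1} \<Longrightarrow> x j \<bullet> u = 0" for u
  proof -
    \<comment> \<open>Parseval counts from 0 while the eigenvectors count from 1, hence the shift by
      \<open>Suc\<close>.\<close>
    have "u \<bullet> u = (\<Sum>j<n. (x (Suc j) \<bullet> u)\<^sup>2)"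
      by (rule parseval_orthonormal) (use u ev(1) orth in auto)
    also have "\<dots> = (\<Sum>j\<in>{1..n}. (x j \<bullet> u)\<^sup>2)"
      by (rule sum.reindex_bij_witness[of _ "\<lambda>j. j - 1" Suc]) auto
    also have "\<dots> = (\<Sum>j\<in>insert i N. (x j \<bullet> u)\<^sup>2)"
    proof (rule sum.mono_neutral_right)
      show "insert i N \<subseteq> {1..n}" using in1 by (auto simp: N)
      show "\<forall>j\<in>{1..n} - insert i N. (x j \<bullet> u)\<^sup>2 = 0" using u(3) by (auto simp: N)
    qed simp
    also have "\<dots> = (x i \<bullet> u)\<^sup>2 + (\<Sum>j\<in>N. (x j \<bullet> u)\<^sup>2)"
      using finN l by (subst sum.insert) (auto simp: N)
    finally have "(u \<bullet> x i)\<^sup>2 + (\<Sum>j\<in>N. (x j \<bullet> u)\<^sup>2) = u \<bullet> u"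
      using comm_scalar_prod[OF u(1) ev(1)[OF in1]] by simp
    then show ?thesis
      using tan_angle_unit[of "x i" u] comm_scalar_prod[OF u(1) ev(1)[OF in1]] orth[OF in1 in1] u(2)
      by (simp add: sum_nonneg)
  qed

  \<comment> \<open>The angle bound for one fixed polynomial \<open>p\<close>\<close>
  have bound: "tan_angle_space (column_space S) (x i)
      \<le> (SUP j\<in>N. ennreal (\<bar>poly (CJ_expansion d a b p) (lam j)\<bar>
                               / \<bar>poly (CJ_expansion d a b p) (lam i)\<bar>)) * tan_angle v (x i)"
    (is "_ \<le> (SUP j\<in>N. ennreal (?R j)) * _")
    if deg: "degree p \<le> M - 1" and F0: "poly (CJ_expansion d a b p) (lam i) \<noteq> 0" for p
  proof -
    let ?F = "CJ_expansion d a b"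
    let ?f = "\<lambda>j. poly (?F p) (lam j)"
    let ?Xs = "map (\<lambda>k. mat_poly (?F (monom 1 k)) A * V) [0..<M]"
    define w where "w = mat_poly (?F p) A *\<^sub>v v"
    have wn: "w \<in> carrier_vec n" unfolding w_def by (rule mult_mat_vec_carrier[OF mat_poly_carrier[OF A] vn])
    have Sn: "dim_row S = n" unfolding S hcat_def by simp
    have "mat_poly (?F (monom 1 k)) A *\<^sub>v v \<in> column_space S" if "k \<in> {..M - 1}" for k
    proof -
      let ?Y = "mat_poly (?F (monom 1 k)) A * V"
      have Y: "?Y \<in> carrier_mat n l" by (rule mult_carrier_mat[OF mat_poly_carrier[OF A] V])
      have "mat_poly (?F (monom 1 k)) A *\<^sub>v v = ?Y *\<^sub>v ?c"
        unfolding vVc using assoc_mult_mat_vec[OF mat_poly_carrier[OF A] V c] by simp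
      then have "mat_poly (?F (monom 1 k)) A *\<^sub>v v \<in> column_space ?Y"
        unfolding mem_column_space_iff[OF Y] using c by blast
      moreover have "column_space ?Y \<subseteq> column_space S"
        unfolding S by (rule hcat_block_column_space) (use A M that in \<open>auto simp: mat_poly_def\<close>)
      ultimately show ?thesis by blast
    qed
    then have wS: "w \<in> column_space S"
      unfolding w_def CJ_expansion_as_sum[OF ab deg, of d]
      by (intro mat_poly_sum_in_column_space) (use A vn Sn in auto)
    have xw: "x j \<bullet> w = ?f j * (x j \<bullet> v)" if "j \<in> {1..n}" for j
      unfolding w_def by (rule scalar_prod_mat_poly_left_eigenvector[OF A ev(1)[OF that] vn ev(2)[OF that]])
    have xiw: "x i \<bullet> w = ?f i" using xw[OF in1] vdual by simp
    \<comment> \<open>Its \<open>i\<close>-th coordinate is nonzero, so \<open>w\<close> is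
      admissible in the infimum that defines the angle to the column space.\<close>
    have "w \<noteq> 0\<^sub>v n" using xiw F0 ev(1)[OF in1] by auto
    then have "w \<in> column_space S - {0\<^sub>v (dim_vec (x i))}" using wS ev(1)[OF in1] by simp
    then have "tan_angle_space (column_space S) (x i) \<le> tan_angle w (x i)"
      unfolding tan_angle_space_def by (rule INF_lower)
    also have "\<dots> = ennreal (sqrt (\<Sum>j\<in>N. (x j \<bullet> w)\<^sup>2) / \<bar>?f i\<bar>)"
    proof (subst tan[OF wn])
      fix j assume j: "j \<in> {i + 1..i + l - 1}"
      then have "j \<in> {1..n}" using i ln by auto
      then show "x j \<bullet> w = 0" using xw vdual(2)[OF j] by simp
    qed (use xiw F0 in simp_all)
    also have "\<dots> \<le> (SUP j\<in>N. ennreal (?R j)) * ennreal (sqrt (\<Sum>j\<in>N. (x j \<bullet> v)\<^sup>2))"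
    \<comment> \<open>\<open>N\<close> is empty exactly when \<open>l = n\<close>; the left side is
      then 0. Otherwise the maximum of the ratios exists as a real \<open>m\<close>, and the
      estimate is carried out over the reals before passing to \<open>ennreal\<close>.\<close>
    proof (cases "N = {}")
      case False
      define m where "m = Max (?R ` N)"
      have "m \<in> ?R ` N" unfolding m_def using finN False by (intro Max_in) auto
      then obtain k where k: "k \<in> N" "m = ?R k" by blast
      then have m0: "0 \<le> m" by simp
      have "(\<Sum>j\<in>N. (x j \<bullet> w)\<^sup>2) \<le> (\<Sum>j\<in>N. (m * \<bar>?f i\<bar>)\<^sup>2 * (x j \<bullet> v)\<^sup>2)"
      proof (rule sum_mono)
        fix j assume j: "j \<in> N"
        then have "?R j \<le> m" unfolding m_def using finN by (intro Max_ge) auto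
        then have "\<bar>?f j\<bar> \<le> m * \<bar>?f i\<bar>" using F0 by (simp add: divide_le_eq)
        then have "(?f j)\<^sup>2 \<le> (m * \<bar>?f i\<bar>)\<^sup>2" by (metis abs_ge_zero power2_abs power_mono)
        moreover have "x j \<bullet> w = ?f j * (x j \<bullet> v)" using j by (intro xw) (simp add: N)
        ultimately show "(x j \<bullet> w)\<^sup>2 \<le> (m * \<bar>?f i\<bar>)\<^sup>2 * (x j \<bullet> v)\<^sup>2"
          by (simp add: power_mult_distrib mult_right_mono)
      qed
      then have "sqrt (\<Sum>j\<in>N. (x j \<bullet> w)\<^sup>2) \<le> sqrt ((m * \<bar>?f i\<bar>)\<^sup>2 * (\<Sum>j\<in>N. (x j \<bullet> v)\<^sup>2))"
        by (simp add: sum_distrib_left)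
      also have "\<dots> = m * sqrt (\<Sum>j\<in>N. (x j \<bullet> v)\<^sup>2) * \<bar>?f i\<bar>"
        using m0 by (simp add: real_sqrt_mult)
      finally have "sqrt (\<Sum>j\<in>N. (x j \<bullet> w)\<^sup>2) / \<bar>?f i\<bar> \<le> m * sqrt (\<Sum>j\<in>N. (x j \<bullet> v)\<^sup>2)"
        using F0 by (simp add: divide_le_eq)
      then have "ennreal (sqrt (\<Sum>j\<in>N. (x j \<bullet> w)\<^sup>2) / \<bar>?f i\<bar>)
          \<le> ennreal m * ennreal (sqrt (\<Sum>j\<in>N. (x j \<bullet> v)\<^sup>2))"
        using m0 by (simp add: ennreal_mult[symmetric] sum_nonneg ennreal_leI)
      \<comment> \<open>The maximum is attained at \<open>k\<close>, so it is one of the terms of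
        the supremum.\<close>
      also have "ennreal m \<le> (SUP j\<in>N. ennreal (?R j))" unfolding k(2) by (rule SUP_upper[OF k(1)])
      finally show ?thesis by (simp add: mult_right_mono)
    qed simp
    \<comment> \<open>The normalisation \<open>x i \<bullet> v = 1\<close> makes the denominator in
      the tangent formula equal to 1.\<close>
    also have "ennreal (sqrt (\<Sum>j\<in>N. (x j \<bullet> v)\<^sup>2)) = tan_angle v (x i)"
      by (subst tan[OF vn]) (use vdual in simp_all)
    finally show ?thesis .
  qed

  show ?thesis
  proof (intro conjI)
    show "\<exists>!w. w \<in> column_space V \<and> x i \<bullet> w = 1 \<and> (\<forall>j\<in>{i + 1..i + l - 1}. x j \<bullet> w = 0)"
      using vcol vdual unique by blast
  \<comment> \<open>The bound holds for every admissible \<open>p\<close>, hence for the infimum;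
    with no admissible \<open>p\<close> the infimum is \<infinity>.\<close>
  qed (use vcol vdual bound in \<open>auto intro!: INF_greatest\<close>)
qed

end
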